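(* Let $0<r_0<r_1$, let $\bar k_{11},\bar k_2,f$ be the functions on $[\theta_-,\theta_+]$ given in the context, and let $$D=\Big\{(y_1,y_2):\ \tfrac1{r_1}f(y_2)<y_1<\tfrac1{r_0}f(y_2),\ \theta_-<y_2<\theta_+\Big\}.$$ There exists a multiplier $\mathcal M\psi=y_1^{-1}d_1(y_2)\partial_{y_1}\psi+y_1^{-2}d_2(y_2)\partial_{y_2}\psi$, with smooth functions $d_1,d_2$ defined on $[\theta_-,\theta_+]$, such that for any smooth function $\psi$ with compact support in $D$, $$\iint_D\big(y_1^2\bar k_{11}(y_2)\partial_{y_1}^2\psi+\partial_{y_2}^2\psi+\bar k_2(y_2)\partial_{y_2}\psi\big)\,\mathcal M\psi\,dy_1dy_2\ \ge\ 2\iint_D\Big[(\partial_{y_1}\psi)^2+\big(\tfrac1{y_1}\partial_{y_2}\psi\big)^2\Big]dy_1dy_2.$$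
   Context: Background flow: fix $\gamma>1$, $A_0,B_0>0$, $\theta_{so}\in(0,\frac\pi2)$, $U_{01},U_{02}>0$ with $U_{01}^2+U_{02}^2=\frac{2(\gamma-1)}{\gamma+1}B_0$. On an interval $[\theta_-,\theta_+]$ with $0<\theta_-<\theta_{so}<\theta_+<\frac\pi2$, $(\bar U_1,\bar U_2)$ is the smooth solution of $$\bar U_1'=\bar U_2,\quad \bar U_2'=-\bar U_1-\frac{\bar U_1\sin\theta+\bar U_2\cos\theta}{(1-\bar M_2^2)\sin\theta},\quad c^2(\bar\rho)=A_0\gamma\bar\rho^{\gamma-1}=(\gamma-1)\big(B_0-\tfrac12(\bar U_1^2+\bar U_2^2)\big),$$ with $(\bar U_1,\bar U_2)(\theta_{so})=(U_{01},U_{02})$, where $\bar M_i=\bar U_i/c(\bar\rho)$; the interval is such that on it $\bar U_1,\bar U_2>0$, $1-\bar M_1^2>0$, $1-\bar M_2^2>0$, and $|\bar{\mathbf M}|^2=\bar M_1^2+\bar M_2^2$ is strictly decreasing with $|\bar{\mathbf M}(\theta_{so})|^2=1$. Coefficients: $\bar A_{12}=-\bar U_1\bar U_2$, $\bar A_{22}=c^2(\bar\rho)-\bar U_2^2$, $f(\theta)=\exp\int_{\theta_c}^\theta\frac{\bar A_{12}}{\bar A_{22}}(\tau)d\tau$ for a fixed reference angle $\theta_c\in[\theta_-,\theta_+]$, $\bar k_{11}=\frac{1-\bar M_1^2-\bar M_2^2}{(1-\bar M_2^2)^2}$, $\bar k_2=e_2/\bar A_{22}$, where $$e_2=(3-\gamma)\bar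 U_2(\bar U_1+\bar U_2\cot\theta)+\frac{(\gamma+1)\bar U_2}{1-\bar M_2^2}(\bar U_1+\bar U_2\cot\theta)+(c^2(\bar\rho)-2\bar U_2^2)\cot\theta.$$ All of these are functions of the angle, evaluated at $y_2$ in the claim. *)

theory Defs
  imports "HOL-Analysis.Analysis"
begin

text \<open>
  The relative derivative \<open>at x within S\<close> is used so that one notion serves both for open sets
  and for compact intervals, where it gives one-sided derivatives at the end points.  It is intended
  for open sets and for nondegenerate intervals, on which the relative derivative is unique.
\<close>

primrec k_smooth_on ::
  "nat \<Rightarrow> 'a::real_normed_vector set \<Rightarrow> ('a \<Rightarrow> 'b::real_normed_vector) \<Rightarrow> bool" where
  "k_smooth_on 0 S f \<longleftrightarrow> continuous_on S f"
| "k_smooth_on (Suc k) S f \<longleftrightarrow>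
     f differentiable_on S \<and>
     (\<forall>v. k_smooth_on k S (\<lambda>x. frechet_derivative f (at x within S) v))"

definition smooth_on ::
  "'a::real_normed_vector set \<Rightarrow> ('a \<Rightarrow> 'b::real_normed_vector) \<Rightarrow> bool" where
  "smooth_on S f \<longleftrightarrow> (\<forall>k. k_smooth_on k S f)"

definition test_function :: "(real \<times> real) set \<Rightarrow> (real \<times> real \<Rightarrow> real) \<Rightarrow> bool" where
  "test_function D \<psi> \<longleftrightarrow>
     smooth_on UNIV \<psi> \<and> compact (closure {y. \<psi> y \<noteq> 0}) \<and> closure {y. \<psi> y \<noteq> 0} \<subseteq> D"

definition pd1 :: "(real \<times> real \<Rightarrow> real) \<Rightarrow> real \<times> real \<Rightarrow> real" where
  "pd1 \<psi> = (\<lambda>(y1, y2). deriv (\<lambda>s. \<psi> (s, y2)) y1)"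

definition pd2 :: "(real \<times> real \<Rightarrow> real) \<Rightarrow> real \<times> real \<Rightarrow> real" where
  "pd2 \<psi> = (\<lambda>(y1, y2). deriv (\<lambda>s. \<psi> (y1, s)) y2)"

definition csq :: "real \<Rightarrow> real \<Rightarrow> real \<Rightarrow> real" where
  "csq \<gamma> A\<^sub>0 \<rho> = A\<^sub>0 * \<gamma> * \<rho> powr (\<gamma> - 1)"

definition mach :: "real \<Rightarrow> real \<Rightarrow> (real \<Rightarrow> real) \<Rightarrow> (real \<Rightarrow> real) \<Rightarrow> real \<Rightarrow> real" where
  "mach \<gamma> A\<^sub>0 \<rho> U \<theta> = U \<theta> / sqrt (csq \<gamma> A\<^sub>0 (\<rho> \<theta>))"

text \<open>
  The positivity of \<open>\<rho>\<close> makes the sound speed positive, so that the Mach numbers are genuine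
  quotients; the Bernoulli relation then determines \<open>\<rho>\<close> on the interval.
\<close>

definition background_flow ::
  "real \<Rightarrow> real \<Rightarrow> real \<Rightarrow> real \<Rightarrow> real \<Rightarrow> real \<Rightarrow> real \<Rightarrow> real \<Rightarrow>
   (real \<Rightarrow> real) \<Rightarrow> (real \<Rightarrow> real) \<Rightarrow> (real \<Rightarrow> real) \<Rightarrow> bool" where
  "background_flow \<gamma> A\<^sub>0 B\<^sub>0 \<theta>so U01 U02 \<theta>m \<theta>p \<rho> U1 U2 \<longleftrightarrow>
     1 < \<gamma> \<and> 0 < A\<^sub>0 \<and> 0 < B\<^sub>0 \<and> 0 < \<theta>so \<and> \<theta>so < pi/2 \<and> 0 < U01 \<and> 0 < U02 \<and>
     U01\<^sup>2 + U02\<^sup>2 = 2 * (\<gamma> - 1) / (\<gamma> + 1) * B\<^sub>0 \<and>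
     0 < \<theta>m \<and> \<theta>m < \<theta>so \<and> \<theta>so < \<theta>p \<and> \<theta>p < pi/2 \<and>
     smooth_on {\<theta>m..\<theta>p} U1 \<and> smooth_on {\<theta>m..\<theta>p} U2 \<and>
     (\<forall>\<theta>\<in>{\<theta>m..\<theta>p}.
        (U1 has_real_derivative U2 \<theta>) (at \<theta> within {\<theta>m..\<theta>p}) \<and>
        (U2 has_real_derivative
           - U1 \<theta> - (U1 \<theta> * sin \<theta> + U2 \<theta> * cos \<theta>) / ((1 - (mach \<gamma> A\<^sub>0 \<rho> U2 \<theta>)\<^sup>2) * sin \<theta>))
          (at \<theta> within {\<theta>m..\<theta>p}) \<and>
        0 < \<rho> \<theta> \<and>
        csq \<gamma> A\<^sub>0 (\<rho> \<theta>) = (\<gamma> - 1) * (B\<^sub>0 - 1/2 * ((U1 \<theta>)\<^sup>2 + (U2 \<theta>)\<^sup>2))) \<and>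
     U1 \<theta>so = U01 \<and> U2 \<theta>so = U02 \<and>
     (\<forall>\<theta>\<in>{\<theta>m..\<theta>p}.
        0 < U1 \<theta> \<and> 0 < U2 \<theta> \<and>
        0 < 1 - (mach \<gamma> A\<^sub>0 \<rho> U1 \<theta>)\<^sup>2 \<and> 0 < 1 - (mach \<gamma> A\<^sub>0 \<rho> U2 \<theta>)\<^sup>2) \<and>
     strict_antimono_on {\<theta>m..\<theta>p} (\<lambda>\<theta>. (mach \<gamma> A\<^sub>0 \<rho> U1 \<theta>)\<^sup>2 + (mach \<gamma> A\<^sub>0 \<rho> U2 \<theta>)\<^sup>2) \<and>
     (mach \<gamma> A\<^sub>0 \<rho> U1 \<theta>so)\<^sup>2 + (mach \<gamma> A\<^sub>0 \<rho> U2 \<theta>so)\<^sup>2 = 1"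

definition coeff_A12 :: "(real \<Rightarrow> real) \<Rightarrow> (real \<Rightarrow> real) \<Rightarrow> real \<Rightarrow> real" where
  "coeff_A12 U1 U2 \<theta> = - U1 \<theta> * U2 \<theta>"

definition coeff_A22 :: "real \<Rightarrow> real \<Rightarrow> (real \<Rightarrow> real) \<Rightarrow> (real \<Rightarrow> real) \<Rightarrow> real \<Rightarrow> real" where
  "coeff_A22 \<gamma> A\<^sub>0 \<rho> U2 \<theta> = csq \<gamma> A\<^sub>0 (\<rho> \<theta>) - (U2 \<theta>)\<^sup>2"

text \<open>The interval integral is oriented, so \<open>\<theta> < \<theta>c\<close> is allowed.\<close>

definition coeff_f ::
  "real \<Rightarrow> real \<Rightarrow> (real \<Rightarrow> real) \<Rightarrow> (real \<Rightarrow> real) \<Rightarrow> (real \<Rightarrow> real) \<Rightarrow> real \<Rightarrow> real \<Rightarrow> real" where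
  "coeff_f \<gamma> A\<^sub>0 \<rho> U1 U2 \<theta>c \<theta> =
     exp (LBINT \<tau>=ereal \<theta>c..ereal \<theta>. coeff_A12 U1 U2 \<tau> / coeff_A22 \<gamma> A\<^sub>0 \<rho> U2 \<tau>)"

definition coeff_k11 ::
  "real \<Rightarrow> real \<Rightarrow> (real \<Rightarrow> real) \<Rightarrow> (real \<Rightarrow> real) \<Rightarrow> (real \<Rightarrow> real) \<Rightarrow> real \<Rightarrow> real" where
  "coeff_k11 \<gamma> A\<^sub>0 \<rho> U1 U2 \<theta> =
     (1 - (mach \<gamma> A\<^sub>0 \<rho> U1 \<theta>)\<^sup>2 - (mach \<gamma> A\<^sub>0 \<rho> U2 \<theta>)\<^sup>2) / (1 - (mach \<gamma> A\<^sub>0 \<rho> U2 \<theta>)\<^sup>2)\<^sup>2"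

definition coeff_e2 ::
  "real \<Rightarrow> real \<Rightarrow> (real \<Rightarrow> real) \<Rightarrow> (real \<Rightarrow> real) \<Rightarrow> (real \<Rightarrow> real) \<Rightarrow> real \<Rightarrow> real" where
  "coeff_e2 \<gamma> A\<^sub>0 \<rho> U1 U2 \<theta> =
     (3 - \<gamma>) * U2 \<theta> * (U1 \<theta> + U2 \<theta> * cot \<theta>)
     + (\<gamma> + 1) * U2 \<theta> / (1 - (mach \<gamma> A\<^sub>0 \<rho> U2 \<theta>)\<^sup>2) * (U1 \<theta> + U2 \<theta> * cot \<theta>)
     + (csq \<gamma> A\<^sub>0 (\<rho> \<theta>) - 2 * (U2 \<theta>)\<^sup>2) * cot \<theta>"

definition coeff_k2 ::
  "real \<Rightarrow> real \<Rightarrow> (real \<Rightarrow> real) \<Rightarrow> (real \<Rightarrow> real) \<Rightarrow> (real \<Rightarrow> real) \<Rightarrow> real \<Rightarrow> real" where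
  "coeff_k2 \<gamma> A\<^sub>0 \<rho> U1 U2 \<theta> = coeff_e2 \<gamma> A\<^sub>0 \<rho> U1 U2 \<theta> / coeff_A22 \<gamma> A\<^sub>0 \<rho> U2 \<theta>"

definition domain_D :: "real \<Rightarrow> real \<Rightarrow> real \<Rightarrow> real \<Rightarrow> (real \<Rightarrow> real) \<Rightarrow> (real \<times> real) set" where
  "domain_D r0 r1 \<theta>m \<theta>p f =
     {(y1, y2). 1 / r1 * f y2 < y1 \<and> y1 < 1 / r0 * f y2 \<and> \<theta>m < y2 \<and> y2 < \<theta>p}"

definition linear_op ::
  "(real \<Rightarrow> real) \<Rightarrow> (real \<Rightarrow> real) \<Rightarrow> (real \<times> real \<Rightarrow> real) \<Rightarrow> real \<times> real \<Rightarrow> real" where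
  "linear_op k11 k2 \<psi> = (\<lambda>(y1, y2).
     y1\<^sup>2 * k11 y2 * pd1 (pd1 \<psi>) (y1, y2) + pd2 (pd2 \<psi>) (y1, y2) + k2 y2 * pd2 \<psi> (y1, y2))"

definition multiplier ::
  "(real \<Rightarrow> real) \<Rightarrow> (real \<Rightarrow> real) \<Rightarrow> (real \<times> real \<Rightarrow> real) \<Rightarrow> real \<times> real \<Rightarrow> real" where
  "multiplier d1 d2 \<psi> = (\<lambda>(y1, y2).
     1 / y1 * d1 y2 * pd1 \<psi> (y1, y2) + 1 / y1\<^sup>2 * d2 y2 * pd2 \<psi> (y1, y2))"

end

theory Submission
  imports Defs
begin

text \<open>
  Integrating the product of the operator and the multiplier by parts leaves a quadratic form in
  \<open>X = \<partial>\<^sub>1 \<psi>\<close> and \<open>Y = \<partial>\<^sub>2 \<psi> / y\<^sub>1\<close>, whose coefficients depend on the angle only: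
  \<open>((K d\<^sub>2)' - K d\<^sub>1) / 2 X\<^sup>2 + (k d\<^sub>1 - d\<^sub>1') X Y + (2 k d\<^sub>2 - d\<^sub>1 - d\<^sub>2') / 2 Y\<^sup>2\<close>,
  with \<open>K\<close> and \<open>k\<close> the two coefficients of the operator (lemma \<open>multiplier_energy_inequality\<close>).  It remains to choose
  \<open>d\<^sub>1\<close> and \<open>d\<^sub>2\<close> such that this form is at least \<open>2 (X\<^sup>2 + Y\<^sup>2)\<close>.

  The operator is of mixed type: \<open>K\<close> is negative on the supersonic side, positive on the subsonic
  side and zero at the sonic angle.  The flow equations give \<open>K = N w\<close> with \<open>w > 0\<close> and
  \<open>N' > 0\<close> on the whole closed interval (lemma \<open>background_flow_coefficients\<close>).  Thus at the
  sonic angle, where \<open>K\<close> cannot contribute, \<open>K' d\<^sub>2\<close> is positive for positive \<open>d\<^sub>2\<close>.  Away from it the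
  aim is that \<open>d\<^sub>2' - d\<^sub>1\<close> has, roughly, the sign of \<open>K\<close>.  A negative \<open>d\<^sub>1\<close> solving \<open>d\<^sub>1' = k d\<^sub>1\<close>
  and a steep decaying exponential for \<open>w d\<^sub>2\<close>, normalised so that the two terms balance at the sonic
  angle, have this property and make all other terms favourable (lemma \<open>multiplier_coefficients_C1\<close>).

  These functions are continuously differentiable and make the form positive definite.  Since
  definiteness is an open condition, Weierstrass approximation replaces them by polynomials, which are
  smooth, and a final scaling yields the constant 2 (lemma \<open>multiplier_coefficients_polynomial\<close>).
\<close>

section \<open>Polynomials on an interval: smoothness and approximation\<close>

text \<open>At points outside \<open>S\<close> the relative derivative of a function is an arbitrary value, so smoothness
  has to be transferred between functions that agree on \<open>S\<close> only.\<close>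

lemma k_smooth_on_cong:
  assumes "\<And>x. x \<in> S \<Longrightarrow> f x = g x"
  shows "k_smooth_on k S f \<longleftrightarrow> k_smooth_on k S g"
  using assms
proof (induction k arbitrary: f g)
  case 0
  then show ?case by (simp cong: continuous_on_cong)
next
  case (Suc k)
  have hd: "(f has_derivative D) (at x within S) \<longleftrightarrow> (g has_derivative D) (at x within S)"
    if "x \<in> S" for x D
    using Suc.prems that
    by (metis has_derivative_transform)
  have "f differentiable_on S \<longleftrightarrow> g differentiable_on S"
    unfolding differentiable_on_def differentiable_def using hd by blast
  moreover have "frechet_derivative f (at x within S) v = frechet_derivative g (at x within S) v"
    if "x \<in> S" for x v
    unfolding frechet_derivative_def using hd[OF that] by simp
  ultimately show ?case
    using Suc.IH[of "\<lambda>x. frechet_derivative f (at x within S) _"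
        "\<lambda>x. frechet_derivative g (at x within S) _"] by simp
qed

lemma smooth_on_real_polynomial:
  fixes p :: "real \<Rightarrow> real"
  assumes "real_polynomial_function p" "a < b"
  shows "smooth_on {a..b} p"
proof -
  have "k_smooth_on k {a..b} p" for k
    using assms(1)
  proof (induction k arbitrary: p)
    case 0
    then show ?case by (simp add: continuous_on_polymonial_function real_polynomial_function_eq)
  next
    case (Suc k)
    obtain p' where p': "real_polynomial_function p'" "\<And>x. (p has_real_derivative p' x) (at x)"
      using has_real_derivative_polynomial_function[OF Suc.prems] by blast
    have fd: "frechet_derivative p (at x within {a..b}) v = p' x * v" if "x \<in> {a..b}" for x v
    proof -
      have "(p has_derivative (*) (p' x)) (at x within {a..b})"
        using p'(2)[of x] by (auto simp: has_field_derivative_def intro: has_derivative_at_withinI)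
      moreover from this have "(p has_derivative frechet_derivative p (at x within {a..b})) (at x within {a..b})"
        using differentiableI frechet_derivative_works by blast
      ultimately have "frechet_derivative p (at x within {a..b}) = (*) (p' x)"
        using frechet_derivative_unique_within_closed_interval[of a b x p] that \<open>a < b\<close>
        by auto
      then show ?thesis by simp
    qed
    have "p differentiable_on {a..b}"
      unfolding differentiable_on_def
      using p'(2) by (meson differentiable_at_withinI real_differentiable_def)
    moreover have "k_smooth_on k {a..b} (\<lambda>x. frechet_derivative p (at x within {a..b}) v)" for v
    proof -
      have "k_smooth_on k {a..b} (\<lambda>x. p' x * v)"
        using real_polynomial_function.intros(4)[OF p'(1) real_polynomial_function.intros(2)]
        by (rule Suc.IH)
      then show ?thesis
        using k_smooth_on_cong[of "{a..b}" "\<lambda>x. frechet_derivative p (at x within {a..b}) v"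
            "\<lambda>x. p' x * v" k] fd by simp
    qed
    ultimately show ?case by simp
  qed
  then show ?thesis by (simp add: smooth_on_def)
qed

lemma real_polynomial_antiderivative:
  fixes q :: "real \<Rightarrow> real"
  assumes "real_polynomial_function q"
  obtains p where "real_polynomial_function p" "\<And>x. (p has_real_derivative q x) (at x)"
proof -
  obtain c n where q: "q = (\<lambda>x. \<Sum>i\<le>n. c i * x ^ i)"
    using assms by (auto simp: real_polynomial_function_iff_sum)
  define p where "p = (\<lambda>x::real. \<Sum>i\<le>n. c i / real (Suc i) * x ^ Suc i)"
  have "real_polynomial_function p"
    unfolding p_def
    by (intro real_polynomial_function_sum real_polynomial_function.intros
        real_polynomial_function_power) auto
  moreover have "(p has_real_derivative q x) (at x)" for x
    unfolding p_def q
    by (rule DERIV_sum) (auto intro!: derivative_eq_intros simp del: power_Suc)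
  ultimately show thesis by (rule that)
qed

text \<open>Approximate the derivative and integrate: the error of the antiderivative that agrees at the
  left end point is at most the length of the interval times the error of the derivative.\<close>

lemma C1_approx_real_polynomial:
  fixes d d' :: "real \<Rightarrow> real"
  assumes "a < b" "0 < e"
    and d: "\<And>t. t \<in> {a..b} \<Longrightarrow> (d has_real_derivative d' t) (at t within {a..b})"
    and d': "continuous_on {a..b} d'"
  obtains p p' where "real_polynomial_function p" "\<And>x. (p has_real_derivative p' x) (at x)"
    "\<And>t. t \<in> {a..b} \<Longrightarrow> \<bar>p t - d t\<bar> \<le> e" "\<And>t. t \<in> {a..b} \<Longrightarrow> \<bar>p' t - d' t\<bar> \<le> e"
proof -
  define \<delta> where "\<delta> = e / (1 + (b - a))"
  have \<delta>: "0 < \<delta>" "\<delta> \<le> e" "\<delta> * (b - a) \<le> e"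
    using assms(1,2) by (auto simp: \<delta>_def field_simps)
  obtain q where q: "real_polynomial_function q" "\<And>t. t \<in> {a..b} \<Longrightarrow> \<bar>d' t - q t\<bar> < \<delta>"
    using Stone_Weierstrass_real_polynomial_function[OF compact_Icc d' \<delta>(1)] by blast
  obtain P where P: "real_polynomial_function P" "\<And>x. (P has_real_derivative q x) (at x)"
    using real_polynomial_antiderivative[OF q(1)] by blast
  define p where "p t = P t + (d a - P a)" for t
  have "real_polynomial_function p"
    unfolding p_def by (intro real_polynomial_function.intros P)
  moreover have pd: "(p has_real_derivative q x) (at x)" for x
    unfolding p_def by (auto intro!: derivative_eq_intros P)
  moreover have "\<bar>p t - d t\<bar> \<le> e" if t: "t \<in> {a..b}" for t
  proof -
    have "norm ((p t - d t) - (p a - d a)) \<le> \<delta> * norm (t - a)"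
    proof (rule field_differentiable_bound)
      fix x assume x: "x \<in> {a..b}"
      show "((\<lambda>t. p t - d t) has_field_derivative q x - d' x) (at x within {a..b})"
        using x by (intro derivative_intros d has_field_derivative_at_within[OF pd])
      show "norm (q x - d' x) \<le> \<delta>" using q(2)[OF x] by (simp add: abs_minus_commute)
    qed (use t in auto)
    also have "\<dots> \<le> \<delta> * (b - a)" using t \<delta>(1) by (intro mult_left_mono) auto
    finally show ?thesis using \<delta>(3) by (simp add: p_def)
  qed
  moreover have "\<bar>q t - d' t\<bar> \<le> e" if "t \<in> {a..b}" for t
    using q(2)[OF that] \<delta>(2) by (simp add: abs_minus_commute)
  ultimately show thesis by (rule that)
qed

section \<open>Mixed partial derivatives\<close>

lemma second_difference_mean_value:
  fixes g p r :: "real \<times> real \<Rightarrow> real"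
  assumes p: "\<And>x y. ((\<lambda>s. g (s, y)) has_real_derivative p (x, y)) (at x)"
    and r: "\<And>x y. ((\<lambda>s. p (x, s)) has_real_derivative r (x, y)) (at y)"
    and h: "0 < h"
  obtains \<xi> \<eta> where "a < \<xi>" "\<xi> < a + h" "b < \<eta>" "\<eta> < b + h"
    "g (a + h, b + h) - g (a, b + h) - g (a + h, b) + g (a, b) = h * h * r (\<xi>, \<eta>)"
proof -
  have "((\<lambda>s. g (s, b + h) - g (s, b)) has_real_derivative p (x, b + h) - p (x, b)) (at x)" for x
    by (intro derivative_intros p)
  then obtain \<xi> where \<xi>: "a < \<xi>" "\<xi> < a + h"
    "g (a + h, b + h) - g (a + h, b) - (g (a, b + h) - g (a, b)) = h * (p (\<xi>, b + h) - p (\<xi>, b))"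
    using MVT2[of a "a + h" "\<lambda>s. g (s, b + h) - g (s, b)" "\<lambda>x. p (x, b + h) - p (x, b)"] h
    by auto
  obtain \<eta> where \<eta>: "b < \<eta>" "\<eta> < b + h" "p (\<xi>, b + h) - p (\<xi>, b) = h * r (\<xi>, \<eta>)"
    using MVT2[of b "b + h" "\<lambda>s. p (\<xi>, s)" "\<lambda>y. r (\<xi>, y)"] h r by auto
  show thesis
    using \<xi> \<eta> by (intro that[of \<xi> \<eta>]) (auto simp: algebra_simps)
qed

text \<open>Both mixed derivatives are limits of the same second difference quotient.\<close>

lemma mixed_partials_commute:
  fixes g p q r t :: "real \<times> real \<Rightarrow> real"
  assumes p: "\<And>x y. ((\<lambda>s. g (s, y)) has_real_derivative p (x, y)) (at x)"
    and r: "\<And>x y. ((\<lambda>s. p (x, s)) has_real_derivative r (x, y)) (at y)"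
    and q: "\<And>x y. ((\<lambda>s. g (x, s)) has_real_derivative q (x, y)) (at y)"
    and t: "\<And>x y. ((\<lambda>s. q (s, y)) has_real_derivative t (x, y)) (at x)"
    and cont: "continuous_on UNIV r" "continuous_on UNIV t"
  shows "r z = t z"
proof (rule ccontr)
  assume "r z \<noteq> t z"
  define e where "e = \<bar>r z - t z\<bar> / 2"
  have e: "0 < e" using \<open>r z \<noteq> t z\<close> by (simp add: e_def)
  obtain \<delta>1 where \<delta>1: "0 < \<delta>1" "\<And>y. dist y z < \<delta>1 \<Longrightarrow> dist (r y) (r z) < e"
    using cont(1) e unfolding continuous_on_iff by (metis UNIV_I)
  obtain \<delta>2 where \<delta>2: "0 < \<delta>2" "\<And>y. dist y z < \<delta>2 \<Longrightarrow> dist (t y) (t z) < e"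
    using cont(2) e unfolding continuous_on_iff by (metis UNIV_I)
  obtain a b where z: "z = (a, b)" by (cases z)
  define h where "h = min \<delta>1 \<delta>2 / 2"
  have h: "0 < h" using \<delta>1 \<delta>2 by (simp add: h_def)
  have near: "dist (\<xi>, \<eta>) z < min \<delta>1 \<delta>2"
    if "a < \<xi>" "\<xi> < a + h" "b < \<eta>" "\<eta> < b + h" for \<xi> \<eta>
  proof -
    have "dist (\<xi>, \<eta>) z \<le> \<bar>\<xi> - a\<bar> + \<bar>\<eta> - b\<bar>"
      unfolding z dist_Pair_Pair dist_real_def by (rule sqrt_sum_squares_le_sum_abs[THEN order_trans]) simp
    also have "\<dots> < min \<delta>1 \<delta>2" using that by (auto simp: h_def min_def split: if_splits)
    finally show ?thesis .
  qed
  obtain \<xi> \<eta> where 1: "a < \<xi>" "\<xi> < a + h" "b < \<eta>" "\<eta> < b + h"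
    "g (a + h, b + h) - g (a, b + h) - g (a + h, b) + g (a, b) = h * h * r (\<xi>, \<eta>)"
    using second_difference_mean_value[OF p r h, of a b] by blast
  obtain \<eta>' \<xi>' where 2: "b < \<eta>'" "\<eta>' < b + h" "a < \<xi>'" "\<xi>' < a + h"
    "g (a + h, b + h) - g (a + h, b) - g (a, b + h) + g (a, b) = h * h * t (\<xi>', \<eta>')"
    using second_difference_mean_value[of "\<lambda>(y, x). g (x, y)" "\<lambda>(y, x). q (x, y)"
        "\<lambda>(y, x). t (x, y)" h b a] q t h by auto
  have "h * h * r (\<xi>, \<eta>) = h * h * t (\<xi>', \<eta>')" using 1(5) 2(5) by linarith
  then have "r (\<xi>, \<eta>) = t (\<xi>', \<eta>')" using h by simp
  moreover have "dist (r (\<xi>, \<eta>)) (r z) < e" "dist (t (\<xi>', \<eta>')) (t z) < e"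
    using near[OF 1(1-4)] near[OF 2(3,4,1,2)] \<delta>1(2) \<delta>2(2) by simp_all
  ultimately show False by (simp add: dist_real_def e_def abs_if split: if_splits)
qed

lemma
  assumes "smooth_on UNIV \<psi>"
  shows smooth_on_continuous: "continuous_on S \<psi>"
    and smooth_on_pd1: "((\<lambda>s. \<psi> (s, y2)) has_real_derivative pd1 \<psi> (y1, y2)) (at y1)"
    and smooth_on_pd2: "((\<lambda>s. \<psi> (y1, s)) has_real_derivative pd2 \<psi> (y1, y2)) (at y2)"
    and smooth_pd1: "smooth_on UNIV (pd1 \<psi>)"
    and smooth_pd2: "smooth_on UNIV (pd2 \<psi>)"
proof -
  have "continuous_on UNIV \<psi>"
    using assms k_smooth_on.simps(1) unfolding smooth_on_def by blast
  then show "continuous_on S \<psi>" by (rule continuous_on_subset) simp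
  have diff: "\<psi> differentiable at y" for y
    using assms k_smooth_on.simps(2)[of 0 UNIV \<psi>] unfolding smooth_on_def differentiable_on_def
    by blast
  have line: "((\<lambda>s. \<psi> (c + s *\<^sub>R v)) has_real_derivative
      frechet_derivative \<psi> (at (c + s *\<^sub>R v)) v) (at s)" for c v s
  proof -
    have "(\<psi> has_derivative frechet_derivative \<psi> (at (c + s *\<^sub>R v))) (at (c + s *\<^sub>R v))"
      using diff frechet_derivative_works by blast
    then have "((\<lambda>s. \<psi> (c + s *\<^sub>R v)) has_derivative
        (\<lambda>h. frechet_derivative \<psi> (at (c + s *\<^sub>R v)) (h *\<^sub>R v))) (at s)"
      by (intro has_derivative_compose[where f = "\<lambda>s. c + s *\<^sub>R v" and g = \<psi>])
        (auto intro!: derivative_eq_intros)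
    moreover have "frechet_derivative \<psi> (at (c + s *\<^sub>R v)) (h *\<^sub>R v)
        = frechet_derivative \<psi> (at (c + s *\<^sub>R v)) v * h" for h
      using linear_frechet_derivative[OF diff] by (simp add: linear_scale)
    ultimately show ?thesis by (simp add: has_field_derivative_def)
  qed
  have d1: "((\<lambda>s. \<psi> (s, y2)) has_real_derivative frechet_derivative \<psi> (at (y1, y2)) (1, 0)) (at y1)"
    for y1 y2 using line[of "(0, y2)" "(1, 0)" y1] by simp
  have d2: "((\<lambda>s. \<psi> (y1, s)) has_real_derivative frechet_derivative \<psi> (at (y1, y2)) (0, 1)) (at y2)"
    for y1 y2 using line[of "(y1, 0)" "(0, 1)" y2] by simp
  have pd: "pd1 \<psi> = (\<lambda>y. frechet_derivative \<psi> (at y) (1, 0))"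
    "pd2 \<psi> = (\<lambda>y. frechet_derivative \<psi> (at y) (0, 1))"
    using d1 d2 by (auto simp: pd1_def pd2_def fun_eq_iff DERIV_imp_deriv)
  show "((\<lambda>s. \<psi> (s, y2)) has_real_derivative pd1 \<psi> (y1, y2)) (at y1)"
    "((\<lambda>s. \<psi> (y1, s)) has_real_derivative pd2 \<psi> (y1, y2)) (at y2)"
    using d1 d2 by (simp_all add: pd)
  have "k_smooth_on k UNIV (\<lambda>y. frechet_derivative \<psi> (at y) v)" for k v
    using assms k_smooth_on.simps(2)[of k UNIV \<psi>] unfolding smooth_on_def by blast
  then show "smooth_on UNIV (pd1 \<psi>)" "smooth_on UNIV (pd2 \<psi>)"
    by (simp_all add: pd smooth_on_def)
qed

lemma pd1_pd2_commute:
  assumes "smooth_on UNIV \<psi>"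
  shows "pd1 (pd2 \<psi>) = pd2 (pd1 \<psi>)"
proof
  fix z
  note s = assms smooth_pd1[OF assms] smooth_pd2[OF assms]
  have "pd2 (pd1 \<psi>) z = pd1 (pd2 \<psi>) z"
    using s by (intro mixed_partials_commute[where g = \<psi> and p = "pd1 \<psi>" and q = "pd2 \<psi>"]
        smooth_on_pd1 smooth_on_pd2 smooth_on_continuous smooth_pd1 smooth_pd2)
  then show "pd1 (pd2 \<psi>) z = pd2 (pd1 \<psi>) z" by simp
qed

section \<open>Integration of derivatives with compact support\<close>

lemma has_real_derivative_zero_off_closed:
  fixes F :: "real \<times> real \<Rightarrow> real" and \<iota> :: "real \<Rightarrow> real \<times> real"
  assumes "closed C" "\<And>y. y \<notin> C \<Longrightarrow> F y = 0" "continuous_on UNIV \<iota>" "\<iota> t \<notin> C"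
  shows "((\<lambda>s. F (\<iota> s)) has_real_derivative 0) (at t)"
proof -
  have "open (\<iota> -` (- C))"
    using assms by (intro open_vimage) auto
  then show ?thesis
    using assms by (intro has_field_derivative_transform_within_open[OF DERIV_const[of 0]]) auto
qed

lemma integrable_zero_off_compact:
  fixes g :: "real \<times> real \<Rightarrow> real"
  assumes "compact C" "continuous_on C g" "\<And>y. y \<notin> C \<Longrightarrow> g y = 0"
  shows "integrable lborel g"
proof -
  have "(\<lambda>y. indicator C y *\<^sub>R g y) = g"
    using assms(3) by (auto simp: indicator_def fun_eq_iff)
  then show ?thesis using borel_integrable_compact[OF assms(1,2)] by simp
qed

text \<open>The gauge integral gives the fundamental theorem of calculus without any regularity of \<open>f'\<close>
  beyond integrability, so the slices of a planar function need no separate continuity argument.\<close>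

lemma integral_derivative_zero_off_bounded:
  fixes f f' :: "real \<Rightarrow> real"
  assumes f: "\<And>x. (f has_real_derivative f' x) (at x)"
    and supp: "\<And>x. B \<le> \<bar>x\<bar> \<Longrightarrow> f x = 0 \<and> f' x = 0"
    and int: "integrable lborel f'"
  shows "integral\<^sup>L lborel f' = 0"
proof -
  define R where "R = \<bar>B\<bar>"
  have "(f' has_integral f R - f (- R)) {-R..R}"
    using f by (intro fundamental_theorem_of_calculus)
      (auto simp: R_def has_real_derivative_iff_has_vector_derivative[symmetric]
        intro: has_field_derivative_at_within)
  moreover have "f R = 0" "f (- R) = 0" using supp by (auto simp: R_def)
  ultimately have "(f' has_integral 0) {-R..R}" by simp
  then have "(f' has_integral 0) UNIV"
    by (rule has_integral_on_superset) (use supp in \<open>auto simp: R_def\<close>)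
  then show ?thesis
    using has_integral_integral_lborel[OF int] has_integral_unique by blast
qed

text \<open>Fubini's theorem reduces both statements to the slices, along which \<open>G\<close> is the derivative of a
  function that vanishes at both ends.\<close>

lemma
  fixes F G :: "real \<times> real \<Rightarrow> real"
  assumes C: "compact C" and supp: "\<And>y. y \<notin> C \<Longrightarrow> F y = 0 \<and> G y = 0"
    and G: "continuous_on C G"
  shows integral_partial1_zero:
      "(\<And>x y. ((\<lambda>s. F (s, y)) has_real_derivative G (x, y)) (at x)) \<Longrightarrow> integral\<^sup>L lborel G = 0"
    and integral_partial2_zero:
      "(\<And>x y. ((\<lambda>s. F (x, s)) has_real_derivative G (x, y)) (at y)) \<Longrightarrow> integral\<^sup>L lborel G = 0"
proof -
  have int: "integrable lborel G"
    using integrable_zero_off_compact[OF C G] supp by blast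
  then have int': "integrable (lborel \<Otimes>\<^sub>M lborel) (case_prod (\<lambda>x y. G (x, y)))"
    by (simp add: lborel_prod)
  obtain B where "\<forall>y\<in>C. norm y < B"
    using compact_imp_bounded[OF C] bounded_pos_less by blast
  then have off: "(x, y) \<notin> C" if "B \<le> \<bar>x\<bar> \<or> B \<le> \<bar>y\<bar>" for x y
    using that norm_fst_le[of x y] norm_snd_le[of y x] by fastforce
  {
    assume d: "\<And>x y. ((\<lambda>s. F (s, y)) has_real_derivative G (x, y)) (at x)"
    have "integral\<^sup>L lborel G = (\<integral>y. (\<integral>x. G (x, y) \<partial>lborel) \<partial>lborel)"
      using lborel_pair.integral_snd[OF int'] by (simp add: lborel_prod)
    also have "\<dots> = (\<integral>y. 0 \<partial>(lborel :: real measure))"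
    proof (rule Bochner_Integration.integral_cong_AE)
      show "AE y in lborel. (\<integral>x. G (x, y) \<partial>lborel) = 0"
        using lborel_pair.AE_integrable_snd[OF int']
        by eventually_elim
          (rule integral_derivative_zero_off_bounded[where B = B, OF d], use off supp in auto)
      show "(\<lambda>y. \<integral>x. G (x, y) \<partial>lborel) \<in> borel_measurable lborel"
        using lborel_pair.integrable_snd[OF int'] by simp
    qed simp
    finally show "integral\<^sup>L lborel G = 0" by simp
  next
    assume d: "\<And>x y. ((\<lambda>s. F (x, s)) has_real_derivative G (x, y)) (at y)"
    have "integral\<^sup>L lborel G = (\<integral>x. (\<integral>y. G (x, y) \<partial>lborel) \<partial>lborel)"
      using lborel_pair.integral_fst[OF int'] by (simp add: lborel_prod)
    also have "\<dots> = (\<integral>y. 0 \<partial>(lborel :: real measure))"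
    proof (rule Bochner_Integration.integral_cong_AE)
      show "AE x in lborel. (\<integral>y. G (x, y) \<partial>lborel) = 0"
        using lborel_pair.AE_integrable_fst[OF int']
        by eventually_elim
          (rule integral_derivative_zero_off_bounded[where B = B, OF d], use off supp in auto)
      show "(\<lambda>x. \<integral>y. G (x, y) \<partial>lborel) \<in> borel_measurable lborel"
        using lborel_pair.integrable_fst[OF int'] by simp
    qed simp
    finally show "integral\<^sup>L lborel G = 0" by simp
  }
qed

section \<open>Choice of the multiplier and its energy inequality\<close>

text \<open>Write \<open>K = N w\<close> and try \<open>d\<^sub>1 = -E\<close> with \<open>E' = k E\<close>, which removes the cross term.
  With \<open>d\<^sub>2 = h / w\<close> the first coefficient is \<open>N' h + N (h' + w E)\<close>.  Its first summand is positive
  whenever \<open>h > 0\<close>; the second is nonnegative as soon as \<open>h' + w E\<close> changes sign from minus to plus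
  at \<open>s\<close>, exactly where \<open>N\<close> does.  A rapidly decaying exponential \<open>h\<close> achieves this: if
  \<open>h t = H exp (-\<Lambda> t)\<close> then \<open>h' + w E = exp (-\<Lambda> t) (\<phi> t - \<Lambda> H)\<close> with
  \<open>\<phi> t = w t E t exp (\<Lambda> t)\<close> increasing for large \<open>\<Lambda>\<close>, and \<open>H\<close> is chosen such that the zero is \<open>s\<close>.
  The decay also makes \<open>- d2'\<close> dominate the remaining terms of the third coefficient.\<close>

lemma multiplier_coefficients_C1:
  fixes k N N' w w' :: "real \<Rightarrow> real"
  assumes ab: "a < b" and s: "s \<in> {a..b}"
    and k: "continuous_on {a..b} k"
    and N: "\<And>t. t \<in> {a..b} \<Longrightarrow> (N has_real_derivative N' t) (at t within {a..b})"
      "\<And>t. t \<in> {a..b} \<Longrightarrow> 0 < N' t" "N s = 0"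
    and w: "\<And>t. t \<in> {a..b} \<Longrightarrow> (w has_real_derivative w' t) (at t within {a..b})"
      "continuous_on {a..b} w'" "\<And>t. t \<in> {a..b} \<Longrightarrow> 0 < w t"
  obtains d1 d1' d2 d2' where
    "\<And>t. t \<in> {a..b} \<Longrightarrow> (d1 has_real_derivative d1' t) (at t within {a..b})"
    "continuous_on {a..b} d1'"
    "\<And>t. t \<in> {a..b} \<Longrightarrow> (d2 has_real_derivative d2' t) (at t within {a..b})"
    "continuous_on {a..b} d2'"
    "\<And>t. t \<in> {a..b} \<Longrightarrow>
       0 < (N' t * w t + N t * w' t) * d2 t + N t * w t * d2' t - N t * w t * d1 t"
    "\<And>t. t \<in> {a..b} \<Longrightarrow> k t * d1 t = d1' t"
    "\<And>t. t \<in> {a..b} \<Longrightarrow> 0 < 2 * k t * d2 t - d1 t - d2' t"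
proof -
  have cw: "continuous_on {a..b} w" using w(1) by (rule DERIV_continuous_on)
  have cl: "continuous_on {a..b} (\<lambda>t. \<bar>w' t / w t\<bar> + 2 * \<bar>k t\<bar>)"
    by (intro continuous_intros w(2) cw k) (use w(3) in force)
  obtain m where m: "\<And>t. t \<in> {a..b} \<Longrightarrow> \<bar>w' t / w t\<bar> + 2 * \<bar>k t\<bar> \<le> m"
    using continuous_attains_sup[OF compact_Icc _ cl] s by blast
  \<comment> \<open>This rate makes \<open>\<phi>\<close> increasing and \<open>2 k d2 - d2'\<close> positive.\<close>
  define \<Lambda> where "\<Lambda> = m + 1"
  have \<Lambda>: "0 < \<Lambda> + w' t / w t + k t" "0 < \<Lambda> + w' t / w t + 2 * k t" if "t \<in> {a..b}" for t
    using m[OF that] unfolding \<Lambda>_def by linarith+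
  have "0 < \<Lambda>" using m[OF s] unfolding \<Lambda>_def by linarith
  obtain I where I: "\<And>t. t \<in> {a..b} \<Longrightarrow> (I has_real_derivative k t) (at t within {a..b})"
    using antiderivative_continuous[OF k] has_real_derivative_iff_has_vector_derivative by metis
  have cI: "continuous_on {a..b} I" using I by (rule DERIV_continuous_on)
  define E where "E t = exp (I t)" for t
  define \<phi> where "\<phi> t = w t * E t * exp (\<Lambda> * t)" for t
  have \<phi>': "(\<phi> has_real_derivative \<phi> t * (\<Lambda> + w' t / w t + k t)) (at t within {a..b})"
    if "t \<in> {a..b}" for t
    unfolding \<phi>_def[abs_def] E_def
    using that w(3)[OF that]
    by (auto intro!: derivative_eq_intros w(1) I simp: field_simps)
  have \<phi>_pos: "0 < \<phi> t" if "t \<in> {a..b}" for t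
    using w(3)[OF that] by (simp add: \<phi>_def E_def)
  have \<phi>'_pos: "0 < \<phi> t * (\<Lambda> + w' t / w t + k t)" if "t \<in> {a..b}" for t
    by (rule mult_pos_pos[OF \<phi>_pos[OF that] \<Lambda>(1)[OF that]])
  have mono: "g x < g y" if g: "\<And>t. t \<in> {a..b} \<Longrightarrow> (g has_real_derivative g' t) (at t within {a..b})"
    "\<And>t. t \<in> {a..b} \<Longrightarrow> 0 < g' t" and xy: "a \<le> x" "x < y" "y \<le> b" for g g' x y
  proof -
    have cont: "continuous_on {x..y} g"
      using DERIV_continuous_on[OF g(1)] by (rule continuous_on_subset) (use xy in auto)
    have der: "\<exists>D. (g has_real_derivative D) (at t) \<and> 0 < D" if "x < t" "t < y" for t
      using g[of t] that xy by (auto simp: at_within_Icc_at)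
    show ?thesis by (rule DERIV_pos_imp_increasing_open[OF xy(2) der cont])
  qed
  have sign: "0 \<le> N t * (\<phi> t - \<phi> s)" if t: "t \<in> {a..b}" for t
  proof (cases t s rule: linorder_cases)
    case less
    then have "N t < N s" "\<phi> t < \<phi> s"
      using t s by (intro mono[OF N(1,2)] mono[OF \<phi>' \<phi>'_pos]; simp)+
    then show ?thesis using N(3) by (intro mult_nonpos_nonpos) auto
  next
    case greater
    then have "N s < N t" "\<phi> s < \<phi> t"
      using t s by (intro mono[OF N(1,2)] mono[OF \<phi>' \<phi>'_pos]; simp)+
    then show ?thesis using N(3) by simp
  qed simp
  define H where "H = \<phi> s / \<Lambda>"
  have H: "0 < H" "\<Lambda> * H = \<phi> s" using \<phi>_pos[OF s] \<open>0 < \<Lambda>\<close> by (auto simp: H_def)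
  define d1 d1' d2 d2' where "d1 t = - E t" and "d1' t = - (k t * E t)"
    and "d2 t = H * exp (- \<Lambda> * t) / w t" and "d2' t = - (d2 t * (\<Lambda> + w' t / w t))" for t
  have d2_pos: "0 < d2 t" if "t \<in> {a..b}" for t using H w(3)[OF that] by (simp add: d2_def)
  have cd2: "continuous_on {a..b} d2"
    unfolding d2_def by (intro continuous_intros cw) (use w(3) in force)
  show thesis
  proof (rule that[of d1 d1' d2 d2'])
    fix t assume t: "t \<in> {a..b}"
    note wt = w(3)[OF t]
    show "(d1 has_real_derivative d1' t) (at t within {a..b})"
      unfolding d1_def[abs_def] d1'_def E_def by (auto intro!: derivative_eq_intros I t)
    show "(d2 has_real_derivative d2' t) (at t within {a..b})"
      unfolding d2_def[abs_def] d2'_def using wt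
      by (auto intro!: derivative_eq_intros w(1) t simp: field_simps)
    show "k t * d1 t = d1' t" by (simp add: d1_def d1'_def)
    have "2 * k t * d2 t - d1 t - d2' t = E t + d2 t * (\<Lambda> + w' t / w t + 2 * k t)"
      by (simp add: d1_def d2'_def algebra_simps)
    also have "\<dots> > 0"
      using mult_pos_pos[OF d2_pos[OF t] \<Lambda>(2)[OF t]] by (simp add: E_def add_pos_pos)
    finally show "0 < 2 * k t * d2 t - d1 t - d2' t" .
    have wd2: "w t * d2 t = H * exp (- \<Lambda> * t)" using wt by (simp add: d2_def)
    have \<phi>t: "w t * E t = exp (- \<Lambda> * t) * \<phi> t"
      by (simp add: \<phi>_def mult.assoc[symmetric] exp_add[symmetric] exp_minus)
    have "(N' t * w t + N t * w' t) * d2 t + N t * w t * d2' t - N t * w t * d1 t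
      = N' t * (w t * d2 t) + N t * (w t * E t - \<Lambda> * (w t * d2 t))"
      using wt by (simp add: d1_def d2'_def field_simps)
    also have "\<dots> = exp (- \<Lambda> * t) * (N' t * H + N t * (\<phi> t - \<phi> s))"
      unfolding wd2 \<phi>t H(2)[symmetric] by (simp add: algebra_simps)
    also have "\<dots> > 0"
      using sign[OF t] N(2)[OF t] H(1) by (intro mult_pos_pos add_pos_nonneg) auto
    finally show "0 < (N' t * w t + N t * w' t) * d2 t + N t * w t * d2' t - N t * w t * d1 t" .
  next
    show "continuous_on {a..b} d1'" unfolding d1'_def E_def by (intro continuous_intros k cI)
    show "continuous_on {a..b} d2'" unfolding d2'_def
      by (intro continuous_intros cd2 w(2) cw) (use w(3) in force)
  qed
qed

text \<open>Positive definiteness of the quadratic form is an open condition on \<open>d1, d1', d2, d2'\<close>, uniformly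
  on the compact interval, so it survives approximation of \<open>d1\<close> and \<open>d2\<close> by polynomials together
  with their first derivatives.  Passing to polynomials makes the multiplier smooth while nothing more
  than continuity of the coefficients \<open>K'\<close> and \<open>k\<close> has to be known.  The constant 2 is reached by
  scaling, the form being linear in \<open>(d1, d2)\<close>.\<close>

lemma multiplier_coefficients_polynomial:
  fixes k K K' d1 d1' d2 d2' :: "real \<Rightarrow> real"
  assumes ab: "a < b"
    and cont: "continuous_on {a..b} k" "continuous_on {a..b} K" "continuous_on {a..b} K'"
      "continuous_on {a..b} d1'" "continuous_on {a..b} d2'"
    and d1: "\<And>t. t \<in> {a..b} \<Longrightarrow> (d1 has_real_derivative d1' t) (at t within {a..b})"
    and d2: "\<And>t. t \<in> {a..b} \<Longrightarrow> (d2 has_real_derivative d2' t) (at t within {a..b})"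
    and pos1: "\<And>t. t \<in> {a..b} \<Longrightarrow> 0 < K' t * d2 t + K t * d2' t - K t * d1 t"
    and cross: "\<And>t. t \<in> {a..b} \<Longrightarrow> k t * d1 t = d1' t"
    and pos2: "\<And>t. t \<in> {a..b} \<Longrightarrow> 0 < 2 * k t * d2 t - d1 t - d2' t"
  obtains p1 p1' p2 p2' where "real_polynomial_function p1" "real_polynomial_function p2"
    "\<And>x. (p1 has_real_derivative p1' x) (at x)" "\<And>x. (p2 has_real_derivative p2' x) (at x)"
    "\<And>t X Y. t \<in> {a..b} \<Longrightarrow>
       2 * (X\<^sup>2 + Y\<^sup>2) \<le> (K' t * p2 t + K t * p2' t - K t * p1 t) / 2 * X\<^sup>2
         + (k t * p1 t - p1' t) * (X * Y) + (2 * k t * p2 t - p1 t - p2' t) / 2 * Y\<^sup>2"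
proof -
  note cd = DERIV_continuous_on[OF d1] DERIV_continuous_on[OF d2]
  define \<alpha> where "\<alpha> t = (K' t * d2 t + K t * d2' t - K t * d1 t) / 2" for t
  define \<kappa> where "\<kappa> t = (2 * k t * d2 t - d1 t - d2' t) / 2" for t
  have "continuous_on {a..b} (\<lambda>t. min (\<alpha> t) (\<kappa> t))"
    unfolding \<alpha>_def \<kappa>_def by (intro continuous_intros cont cd) auto
  then obtain t0 where t0: "t0 \<in> {a..b}" "\<And>t. t \<in> {a..b} \<Longrightarrow> min (\<alpha> t0) (\<kappa> t0) \<le> min (\<alpha> t) (\<kappa> t)"
    using continuous_attains_inf[OF compact_Icc, of a b "\<lambda>t. min (\<alpha> t) (\<kappa> t)"] ab by auto
  define m where "m = min (\<alpha> t0) (\<kappa> t0)"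
  have m: "0 < m" "\<And>t. t \<in> {a..b} \<Longrightarrow> m \<le> \<alpha> t" "\<And>t. t \<in> {a..b} \<Longrightarrow> m \<le> \<kappa> t"
    using pos1[OF t0(1)] pos2[OF t0(1)] t0(2) by (auto simp: m_def \<alpha>_def \<kappa>_def)
  have "continuous_on {a..b} (\<lambda>t. \<bar>k t\<bar> + \<bar>K t\<bar> + \<bar>K' t\<bar>)"
    by (intro continuous_intros cont)
  then obtain B where B: "\<And>t. t \<in> {a..b} \<Longrightarrow> \<bar>k t\<bar> + \<bar>K t\<bar> + \<bar>K' t\<bar> \<le> B"
    using continuous_attains_sup[OF compact_Icc, of a b "\<lambda>t. \<bar>k t\<bar> + \<bar>K t\<bar> + \<bar>K' t\<bar>"] t0(1) by blast
  have "0 \<le> B" using B[OF t0(1)] by linarith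
  \<comment> \<open>An error \<open>e\<close> in each of the four functions moves every coefficient of the form by at most \<open>m / 4\<close>.\<close>
  define e where "e = m / (4 * (B + 1))"
  have e: "0 < e" "(B + 1) * e = m / 4" using \<open>0 \<le> B\<close> m(1) by (auto simp: e_def field_simps)
  obtain q1 q1' where q1: "real_polynomial_function q1" "\<And>x. (q1 has_real_derivative q1' x) (at x)"
    "\<And>t. t \<in> {a..b} \<Longrightarrow> \<bar>q1 t - d1 t\<bar> \<le> e" "\<And>t. t \<in> {a..b} \<Longrightarrow> \<bar>q1' t - d1' t\<bar> \<le> e"
    using C1_approx_real_polynomial[OF ab e(1) d1 cont(4)] by blast
  obtain q2 q2' where q2: "real_polynomial_function q2" "\<And>x. (q2 has_real_derivative q2' x) (at x)"
    "\<And>t. t \<in> {a..b} \<Longrightarrow> \<bar>q2 t - d2 t\<bar> \<le> e" "\<And>t. t \<in> {a..b} \<Longrightarrow> \<bar>q2' t - d2' t\<bar> \<le> e"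
    using C1_approx_real_polynomial[OF ab e(1) d2 cont(5)] by blast
  have form: "m / 2 * (X\<^sup>2 + Y\<^sup>2) \<le> (K' t * q2 t + K t * q2' t - K t * q1 t) / 2 * X\<^sup>2
         + (k t * q1 t - q1' t) * (X * Y) + (2 * k t * q2 t - q1 t - q2' t) / 2 * Y\<^sup>2"
    (is "_ \<le> ?A * X\<^sup>2 + ?B * (X * Y) + ?C * Y\<^sup>2") if t: "t \<in> {a..b}" for t X Y
  proof -
    define \<epsilon> where "\<epsilon> u = \<bar>u\<bar> * e" for u :: real
    have prod: "u * x - u * y \<le> \<epsilon> u" "u * y - u * x \<le> \<epsilon> u" if "\<bar>x - y\<bar> \<le> e" for u x y :: real
    proof -
      have "\<bar>u * x - u * y\<bar> \<le> \<epsilon> u"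
        using mult_left_mono[OF that abs_ge_zero[of u]]
        unfolding \<epsilon>_def right_diff_distrib[symmetric] abs_mult .
      then show "u * x - u * y \<le> \<epsilon> u" "u * y - u * x \<le> \<epsilon> u" by linarith+
    qed
    have q: "q1 t - d1 t \<le> e" "d1 t - q1 t \<le> e" "q1' t - d1' t \<le> e" "d1' t - q1' t \<le> e"
      "q2' t - d2' t \<le> e" "d2' t - q2' t \<le> e"
      using q1(3,4)[OF t] q2(4)[OF t] by linarith+
    have \<epsilon>: "\<epsilon> (k t) + \<epsilon> (K t) + \<epsilon> (K' t) + e \<le> m / 4" "0 \<le> \<epsilon> (k t)" "0 \<le> \<epsilon> (K t)" "0 \<le> \<epsilon> (K' t)"
      using mult_right_mono[OF B[OF t], of e] e by (auto simp: \<epsilon>_def algebra_simps)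
    have "2 * m \<le> K' t * d2 t + K t * d2' t - K t * d1 t"
      using m(2)[OF t] by (simp add: \<alpha>_def)
    then have "3 / 2 * m \<le> K' t * q2 t + K t * q2' t - K t * q1 t"
      using prod[OF q1(3)[OF t], of "K t"] prod[OF q2(4)[OF t], of "K t"]
        prod[OF q2(3)[OF t], of "K' t"] \<epsilon> m(1) e(1) by linarith
    then have A: "3 / 4 * m \<le> ?A" by simp
    have "2 * m \<le> 2 * (k t * d2 t) - d1 t - d2' t"
      using m(3)[OF t] by (simp add: \<kappa>_def)
    then have "3 / 2 * m \<le> 2 * (k t * q2 t) - q1 t - q2' t"
      using prod[OF q2(3)[OF t], of "k t"] q \<epsilon> m(1) e(1) by linarith
    then have C: "3 / 4 * m \<le> ?C" by simp
    have "?B \<le> m / 4" "- ?B \<le> m / 4"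
      using prod[OF q1(3)[OF t], of "k t"] q cross[OF t] \<epsilon> by linarith+
    then have "\<bar>?B\<bar> \<le> m / 4" by (rule abs_leI)
    then have "\<bar>?B * (X * Y)\<bar> \<le> m / 4 * \<bar>X * Y\<bar>" 
      unfolding abs_mult[of ?B] by (rule mult_right_mono) simp
    also have "\<dots> \<le> m / 4 * (X\<^sup>2 + Y\<^sup>2)"
    proof -
      have "2 * \<bar>X * Y\<bar> \<le> X\<^sup>2 + Y\<^sup>2"
        using sum_squares_bound[of "\<bar>X\<bar>" "\<bar>Y\<bar>"] by (simp add: abs_mult mult.assoc)
      then have "\<bar>X * Y\<bar> \<le> X\<^sup>2 + Y\<^sup>2" by linarith
      then show ?thesis using m(1) by (intro mult_left_mono) auto
    qed
    finally have "- (m / 4 * (X\<^sup>2 + Y\<^sup>2)) \<le> ?B * (X * Y)" by linarith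
    moreover have "3 / 4 * m * X\<^sup>2 \<le> ?A * X\<^sup>2" "3 / 4 * m * Y\<^sup>2 \<le> ?C * Y\<^sup>2"
      using mult_right_mono[OF A, of "X\<^sup>2"] mult_right_mono[OF C, of "Y\<^sup>2"] by simp_all
    moreover have "m / 2 * (X\<^sup>2 + Y\<^sup>2)
        = 3 / 4 * m * X\<^sup>2 + 3 / 4 * m * Y\<^sup>2 - m / 4 * (X\<^sup>2 + Y\<^sup>2)"
      by (simp add: field_simps)
    ultimately show ?thesis by linarith
  qed
  define c where "c = 4 / m"
  have c: "0 < c" "c * m = 4" using m(1) by (auto simp: c_def)
  show thesis
  proof (rule that[of "\<lambda>t. c * q1 t" "\<lambda>t. c * q2 t" "\<lambda>t. c * q1' t" "\<lambda>t. c * q2' t"])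
    show "real_polynomial_function (\<lambda>t. c * q1 t)" "real_polynomial_function (\<lambda>t. c * q2 t)"
      using real_polynomial_function.intros(4)[OF real_polynomial_function.intros(2)] q1(1) q2(1)
      by blast+
    show "((\<lambda>t. c * q1 t) has_real_derivative c * q1' x) (at x)"
      "((\<lambda>t. c * q2 t) has_real_derivative c * q2' x) (at x)" for x
      by (intro DERIV_cmult q1 q2)+
    fix t X Y assume t: "t \<in> {a..b}"
    show "2 * (X\<^sup>2 + Y\<^sup>2) \<le> (K' t * (c * q2 t) + K t * (c * q2' t) - K t * (c * q1 t)) / 2 * X\<^sup>2
         + (k t * (c * q1 t) - c * q1' t) * (X * Y)
         + (2 * k t * (c * q2 t) - c * q1 t - c * q2' t) / 2 * Y\<^sup>2"
      (is "?l \<le> ?r")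
    proof -
      have "?l = (c * m) / 2 * (X\<^sup>2 + Y\<^sup>2)" using c(2) by simp
      also have "\<dots> = c * (m / 2 * (X\<^sup>2 + Y\<^sup>2))" by simp
      also have "\<dots> \<le> c * ((K' t * q2 t + K t * q2' t - K t * q1 t) / 2 * X\<^sup>2
         + (k t * q1 t - q1' t) * (X * Y) + (2 * k t * q2 t - q1 t - q2' t) / 2 * Y\<^sup>2)"
        by (intro mult_left_mono form t less_imp_le c)
      also have "\<dots> = ?r" by (simp add: field_simps)
      finally show ?thesis .
    qed
  qed
qed

text \<open>Two integrations by parts are performed at once, in pointwise form: with \<open>\<psi>\<^sub>1, \<psi>\<^sub>2\<close> for the first
  partial derivatives, the product of operator and multiplier equals the quadratic form at
  \<open>X = \<psi>\<^sub>1, Y = \<psi>\<^sub>2 / y\<^sub>1\<close> plus a divergence \<open>\<partial>\<^sub>1 F + \<partial>\<^sub>2 G\<close>, where \<open>F\<close> and \<open>G\<close> are quadratic in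
  \<open>\<psi>\<^sub>1, \<psi>\<^sub>2\<close> and hence vanish off the support of \<open>\<psi>\<close>.  The two mixed second
  derivatives of \<open>\<psi>\<close>, one occurring in \<open>\<partial>\<^sub>1 F\<close> and the other with opposite sign in \<open>\<partial>\<^sub>2 G\<close>, cancel
  because they are equal.\<close>

lemma multiplier_energy_inequality:
  fixes K K' k d1 d1' d2 d2' :: "real \<Rightarrow> real" and \<psi> :: "real \<times> real \<Rightarrow> real"
  assumes k: "continuous_on {a<..<b} k" and K': "continuous_on {a<..<b} K'"
    and d1': "continuous_on {a<..<b} d1'" and d2': "continuous_on {a<..<b} d2'"
    and K: "\<And>t. t \<in> {a<..<b} \<Longrightarrow> (K has_real_derivative K' t) (at t)"
    and d1: "\<And>t. t \<in> {a<..<b} \<Longrightarrow> (d1 has_real_derivative d1' t) (at t)"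
    and d2: "\<And>t. t \<in> {a<..<b} \<Longrightarrow> (d2 has_real_derivative d2' t) (at t)"
    and form: "\<And>t X Y. t \<in> {a<..<b} \<Longrightarrow>
       2 * (X\<^sup>2 + Y\<^sup>2) \<le> (K' t * d2 t + K t * d2' t - K t * d1 t) / 2 * X\<^sup>2
         + (k t * d1 t - d1' t) * (X * Y) + (2 * k t * d2 t - d1 t - d2' t) / 2 * Y\<^sup>2"
    and \<psi>: "test_function D \<psi>" and D: "D \<subseteq> {0<..} \<times> {a<..<b}"
  shows "2 * (LINT y:D|lborel. (pd1 \<psi> y)\<^sup>2 + (1 / fst y * pd2 \<psi> y)\<^sup>2)
    \<le> (LINT y:D|lborel. linear_op K k \<psi> y * multiplier d1 d2 \<psi> y)"
proof -
  define C where "C = closure {y. \<psi> y \<noteq> 0}"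
  have s: "smooth_on UNIV \<psi>" and C: "compact C" and CD: "C \<subseteq> D"
    using \<psi> by (auto simp: test_function_def C_def)
  have CS: "0 < y1 \<and> y2 \<in> {a<..<b}" if "(y1, y2) \<in> C" for y1 y2
    using that CD D by auto
  define p q where "p = pd1 \<psi>" and "q = pd2 \<psi>"
  define pp pq qq where "pp = pd1 p" and "pq = pd2 p" and "qq = pd2 q"
  have smooth: "smooth_on UNIV p" "smooth_on UNIV q" "smooth_on UNIV pp" "smooth_on UNIV pq"
    "smooth_on UNIV qq"
    using s by (simp_all add: p_def q_def pp_def pq_def qq_def smooth_pd1 smooth_pd2)
  note cont = smooth[THEN smooth_on_continuous]
  have D1: "((\<lambda>s. p (s, y)) has_real_derivative pp (x, y)) (at x)"
    "((\<lambda>s. q (s, y)) has_real_derivative pq (x, y)) (at x)" for x y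
    using smooth_on_pd1[OF smooth(1)] smooth_on_pd1[OF smooth(2)] pd1_pd2_commute[OF s]
    by (simp_all add: pp_def pq_def p_def q_def)
  have D2: "((\<lambda>s. p (x, s)) has_real_derivative pq (x, y)) (at y)"
    "((\<lambda>s. q (x, s)) has_real_derivative qq (x, y)) (at y)" for x y
    using smooth_on_pd2[OF smooth(1)] smooth_on_pd2[OF smooth(2)] by (simp_all add: pq_def qq_def)
  have \<psi>0: "\<psi> y = 0" if "y \<notin> C" for y
    using that closure_subset[of "{y. \<psi> y \<noteq> 0}"] by (auto simp: C_def)
  have off: "p y = 0" "q y = 0" if y: "y \<notin> C" for y
  proof -
    obtain y1 y2 where y12: "y = (y1, y2)" by (cases y)
    have "((\<lambda>s. \<psi> (s, y2)) has_real_derivative 0) (at y1)"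
      using C \<psi>0 y y12
      by (intro has_real_derivative_zero_off_closed[where C = C] compact_imp_closed continuous_intros) auto
    then show "p y = 0"
      using smooth_on_pd1[OF s, of y2 y1] DERIV_unique by (auto simp: p_def y12)
    have "((\<lambda>s. \<psi> (y1, s)) has_real_derivative 0) (at y2)"
      using C \<psi>0 y y12
      by (intro has_real_derivative_zero_off_closed[where C = C] compact_imp_closed continuous_intros) auto
    then show "q y = 0"
      using smooth_on_pd2[OF s, of y1 y2] DERIV_unique by (auto simp: q_def y12)
  qed
  have lift: "continuous_on C (\<lambda>y. g (snd y))" if "continuous_on {a<..<b} g" for g :: "real \<Rightarrow> real"
    by (rule continuous_on_compose2[OF that continuous_on_snd[OF continuous_on_id]]) (use CS in auto)
  have dcont: "continuous_on {a<..<b} g"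
    if "\<And>t. t \<in> {a<..<b} \<Longrightarrow> (g has_real_derivative g' t) (at t)" for g g' :: "real \<Rightarrow> real"
    using that by (meson DERIV_isCont continuous_at_imp_continuous_on)
  note coeff = lift[OF k] lift[OF K'] lift[OF d1'] lift[OF d2'] lift[OF dcont[OF K]]
    lift[OF dcont[OF d1]] lift[OF dcont[OF d2]]
  have fst_nz: "\<forall>y\<in>C. fst y \<noteq> 0" "\<forall>y\<in>C. (fst y)\<^sup>2 \<noteq> 0" using CS by force+
  define F where "F = (\<lambda>(x, y). x * K y * d1 y / 2 * (p (x, y))\<^sup>2 + K y * d2 y * p (x, y) * q (x, y)
      - d1 y / (2 * x) * (q (x, y))\<^sup>2)"
  define F' where "F' y = K (snd y) * d1 (snd y) / 2 * (p y)\<^sup>2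
      + fst y * K (snd y) * d1 (snd y) * p y * pp y
      + K (snd y) * d2 (snd y) * (pp y * q y + p y * pq y)
      + d1 (snd y) / (2 * (fst y)\<^sup>2) * (q y)\<^sup>2 - d1 (snd y) / fst y * q y * pq y" for y
  define G where "G = (\<lambda>(x, y). - (K y * d2 y / 2) * (p (x, y))\<^sup>2 + d1 y / x * p (x, y) * q (x, y)
      + d2 y / (2 * x\<^sup>2) * (q (x, y))\<^sup>2)"
  define G' where "G' y = - ((K' (snd y) * d2 (snd y) + K (snd y) * d2' (snd y)) / 2) * (p y)\<^sup>2
      - K (snd y) * d2 (snd y) * p y * pq y
      + d1' (snd y) / fst y * p y * q y + d1 (snd y) / fst y * (pq y * q y + p y * qq y)
      + d2' (snd y) / (2 * (fst y)\<^sup>2) * (q y)\<^sup>2 + d2 (snd y) / (fst y)\<^sup>2 * q y * qq y" for y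
  have F0: "F y = 0 \<and> F' y = 0" and G0: "G y = 0 \<and> G' y = 0" if "y \<notin> C" for y
    using off[OF that] by (auto simp: F_def F'_def G_def G'_def split: prod.splits)
  have "integral\<^sup>L lborel F' = 0"
  proof (rule integral_partial1_zero[OF C F0])
    show "continuous_on C F'"
      unfolding F'_def by (intro continuous_intros coeff cont) (use fst_nz in auto)
    show "((\<lambda>s. F (s, y)) has_real_derivative F' (x, y)) (at x)" for x y
    proof (cases "(x, y) \<in> C")
      case True
      then have "0 < x" using CS by blast
      then show ?thesis
        unfolding F_def F'_def prod.case
        by (auto intro!: derivative_eq_intros D1 simp: field_simps power2_eq_square)
    next
      case False
      then have "((\<lambda>s. F (s, y)) has_real_derivative 0) (at x)"
        using C F0
        by (intro has_real_derivative_zero_off_closed[where C = C] compact_imp_closed continuous_intros) auto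
      then show ?thesis using F0[OF False] by simp
    qed
  qed
  moreover have "integral\<^sup>L lborel G' = 0"
  proof (rule integral_partial2_zero[OF C G0])
    show "continuous_on C G'"
      unfolding G'_def by (intro continuous_intros coeff cont) (use fst_nz in auto)
    show "((\<lambda>s. G (x, s)) has_real_derivative G' (x, y)) (at y)" for x y
    proof (cases "(x, y) \<in> C")
      case True
      then have x: "0 < x" and y: "y \<in> {a<..<b}" using CS by blast+
      show ?thesis
        unfolding G_def G'_def prod.case using x
        by (auto intro!: derivative_eq_intros D2 K[OF y] d1[OF y] d2[OF y]
            simp: field_simps power2_eq_square)
    next
      case False
      then have "((\<lambda>s. G (x, s)) has_real_derivative 0) (at y)"
        using C G0
        by (intro has_real_derivative_zero_off_closed[where C = C] compact_imp_closed continuous_intros) auto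
      then show ?thesis using G0[OF False] by simp
    qed
  qed
  moreover have "integrable lborel F'" "integrable lborel G'"
    unfolding F'_def G'_def
    by (rule integrable_zero_off_compact[OF C], intro continuous_intros coeff cont,
        use fst_nz off in auto)+
  ultimately have div: "integrable lborel (\<lambda>y. F' y + G' y)" "(\<integral>y. F' y + G' y \<partial>lborel) = 0"
    by simp_all
  define L where "L y = linear_op K k \<psi> y * multiplier d1 d2 \<psi> y" for y
  define R where "R y = (p y)\<^sup>2 + (1 / fst y * q y)\<^sup>2" for y
  have L: "L y = ((fst y)\<^sup>2 * K (snd y) * pp y + qq y + k (snd y) * q y)
      * (1 / fst y * d1 (snd y) * p y + 1 / (fst y)\<^sup>2 * d2 (snd y) * q y)" for y
    by (simp add: L_def linear_op_def multiplier_def pp_def qq_def p_def q_def split: prod.splits)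
  have L0: "L y = 0" and R0: "R y = 0" if "y \<notin> C" for y
    using off[OF that] by (auto simp: L R_def)
  have iL: "integrable lborel L"
    by (rule integrable_zero_off_compact[OF C _ L0], unfold L, intro continuous_intros coeff cont)
      (use fst_nz in auto)
  have iR: "integrable lborel R"
    by (rule integrable_zero_off_compact[OF C _ R0], unfold R_def, intro continuous_intros cont)
      (use fst_nz in auto)
  have pointwise: "2 * R y + (F' y + G' y) \<le> L y" for y
  proof (cases "y \<in> C")
    case True
    obtain x t where y: "y = (x, t)" by (cases y)
    have x: "0 < x" and t: "t \<in> {a<..<b}" using CS True y by blast+
    have "L y - (F' y + G' y) = (K' t * d2 t + K t * d2' t - K t * d1 t) / 2 * (p y)\<^sup>2
         + (k t * d1 t - d1' t) * (p y * (1 / x * q y))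
         + (2 * k t * d2 t - d1 t - d2' t) / 2 * (1 / x * q y)\<^sup>2"
      using x unfolding L F'_def G'_def y fst_conv snd_conv
      by (simp add: field_simps power2_eq_square)
    also have "\<dots> \<ge> 2 * R y" using form[OF t, of "p y" "1 / x * q y"] by (simp add: R_def y)
    finally show ?thesis by simp
  next
    case False
    then show ?thesis using F0 G0 L0 R0 by simp
  qed
  have restrict: "(LINT y:D|lborel. g y) = integral\<^sup>L lborel g"
    if "\<And>y. y \<notin> C \<Longrightarrow> g y = 0" for g :: "real \<times> real \<Rightarrow> real"
    unfolding set_lebesgue_integral_def
    by (rule Bochner_Integration.integral_cong) (use that CD in \<open>auto simp: indicator_def\<close>)
  have "2 * integral\<^sup>L lborel R = (\<integral>y. 2 * R y + (F' y + G' y) \<partial>lborel)"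
    using div iR by simp
  also have "\<dots> \<le> integral\<^sup>L lborel L"
    using div(1) iR iL pointwise by (intro integral_mono) auto
  finally show ?thesis
    using restrict[of L, OF L0] restrict[of R, OF R0] by (simp add: L_def R_def p_def q_def)
qed

section \<open>The coefficients of the background flow\<close>

text \<open>Here \<open>N\<close> is \<open>1 - M\<^sup>2\<close> for the total Mach number \<open>M\<close>, and \<open>w\<close> is \<open>1 / (1 - M\<^sub>2\<^sup>2)\<^sup>2\<close>.
  Writing the flow equations as \<open>U1' = U2\<close>, \<open>U2' = - U1 - g\<close> with \<open>g > 0\<close>, the squared speed has
  derivative \<open>- 2 U2 g\<close>, and Bernoulli's law turns this into \<open>N' = 2 (\<gamma> - 1) B\<^sub>0 U2 g / c\<^sup>2\<close> with \<open>c\<close> the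
  squared sound speed.  Its strict positivity at the sonic angle is what makes the derivative of \<open>N w\<close> positive
  where \<open>N w\<close> itself vanishes.\<close>

lemma background_flow_coefficients:
  assumes flow: "background_flow \<gamma> A\<^sub>0 B\<^sub>0 \<theta>so U01 U02 \<theta>m \<theta>p \<rho> U1 U2"
  obtains N N' w w' where
    "\<And>t. t \<in> {\<theta>m..\<theta>p} \<Longrightarrow> (N has_real_derivative N' t) (at t within {\<theta>m..\<theta>p})"
    "continuous_on {\<theta>m..\<theta>p} N'" "\<And>t. t \<in> {\<theta>m..\<theta>p} \<Longrightarrow> 0 < N' t" "N \<theta>so = 0"
    "\<And>t. t \<in> {\<theta>m..\<theta>p} \<Longrightarrow> (w has_real_derivative w' t) (at t within {\<theta>m..\<theta>p})"
    "continuous_on {\<theta>m..\<theta>p} w'" "\<And>t. t \<in> {\<theta>m..\<theta>p} \<Longrightarrow> 0 < w t"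
    "\<And>t. t \<in> {\<theta>m..\<theta>p} \<Longrightarrow> coeff_k11 \<gamma> A\<^sub>0 \<rho> U1 U2 t = N t * w t"
    "continuous_on {\<theta>m..\<theta>p} (coeff_k2 \<gamma> A\<^sub>0 \<rho> U1 U2)"
proof -
  let ?I = "{\<theta>m..\<theta>p}"
  \<comment> \<open>\<open>\<mu>\<close> is the square \<open>M\<^sub>2\<^sup>2\<close> of the angular Mach number.\<close>
  define c where "c t = (\<gamma> - 1) * (B\<^sub>0 - 1/2 * ((U1 t)\<^sup>2 + (U2 t)\<^sup>2))" for t
  define \<mu> where "\<mu> t = (U2 t)\<^sup>2 / c t" for t
  define g where "g t = (U1 t * sin t + U2 t * cos t) / ((1 - \<mu> t) * sin t)" for t
  have par: "1 < \<gamma>" "0 < A\<^sub>0" "0 < B\<^sub>0" "0 < \<theta>m" "\<theta>m < \<theta>so" "\<theta>so < \<theta>p" "\<theta>p < pi/2"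
    using flow by (auto simp: background_flow_def)
  have csq: "csq \<gamma> A\<^sub>0 (\<rho> t) = c t" "0 < c t" if "t \<in> ?I" for t
  proof -
    have "0 < \<rho> t" and "csq \<gamma> A\<^sub>0 (\<rho> t) = c t"
      using flow that by (auto simp: background_flow_def c_def)
    then show "csq \<gamma> A\<^sub>0 (\<rho> t) = c t" "0 < c t"
      using par by (auto simp: csq_def intro!: mult_pos_pos simp flip: \<open>csq \<gamma> A\<^sub>0 (\<rho> t) = c t\<close>)
  qed
  have mach: "(mach \<gamma> A\<^sub>0 \<rho> U t)\<^sup>2 = (U t)\<^sup>2 / c t" if "t \<in> ?I" for U t
    using csq[OF that] by (simp add: mach_def power_divide)
  have pos: "0 < U1 t" "0 < U2 t" "\<mu> t < 1" if "t \<in> ?I" for t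
  proof -
    have "0 < U1 t \<and> 0 < U2 t \<and> 0 < 1 - (mach \<gamma> A\<^sub>0 \<rho> U2 t)\<^sup>2"
      using flow that unfolding background_flow_def by blast
    then show "0 < U1 t" "0 < U2 t" "\<mu> t < 1"
      by (simp_all add: mach[OF that] \<mu>_def)
  qed
  have trig: "0 < sin t" "0 < cos t" if "t \<in> ?I" for t
    using that par by (auto intro!: sin_gt_zero cos_gt_zero)
  have g: "0 < g t" if "t \<in> ?I" for t
    unfolding g_def using pos[OF that] trig[OF that]
    by (intro divide_pos_pos mult_pos_pos add_pos_pos) auto
  have U': "(U1 has_real_derivative U2 t) (at t within ?I)"
    "(U2 has_real_derivative - U1 t - g t) (at t within ?I)" if "t \<in> ?I" for t
  proof -
    have "(U1 has_real_derivative U2 t) (at t within ?I) \<and> (U2 has_real_derivative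
        - U1 t - (U1 t * sin t + U2 t * cos t) / ((1 - (mach \<gamma> A\<^sub>0 \<rho> U2 t)\<^sup>2) * sin t)) (at t within ?I)"
      using flow that unfolding background_flow_def by blast
    then show "(U1 has_real_derivative U2 t) (at t within ?I)"
      "(U2 has_real_derivative - U1 t - g t) (at t within ?I)"
      by (simp_all add: mach[OF that] g_def \<mu>_def)
  qed
  have c': "(c has_real_derivative (\<gamma> - 1) * U2 t * g t) (at t within ?I)" if "t \<in> ?I" for t
    unfolding c_def[abs_def]
    by (auto intro!: derivative_eq_intros U' that simp: field_simps power2_eq_square)
  have cU: "continuous_on ?I U1" "continuous_on ?I U2"
    by (auto intro: DERIV_continuous_on U')
  have nz: "\<forall>t\<in>?I. c t \<noteq> 0" "\<forall>t\<in>?I. sin t \<noteq> 0" "\<forall>t\<in>?I. 1 - \<mu> t \<noteq> 0"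
    using csq(2) trig(1) pos(3) by (metis less_irrefl, metis less_irrefl, force)
  have cc: "continuous_on ?I c" unfolding c_def by (intro continuous_intros cU)
  have c\<mu>: "continuous_on ?I \<mu>" unfolding \<mu>_def by (intro continuous_intros cU cc nz)
  have cg: "continuous_on ?I g" unfolding g_def by (intro continuous_intros cU c\<mu>) (use nz in auto)
  define \<mu>' where "\<mu>' t = (2 * U2 t * (- U1 t - g t) * c t - (U2 t)\<^sup>2 * ((\<gamma> - 1) * U2 t * g t)) / (c t)\<^sup>2" for t
  have \<mu>': "(\<mu> has_real_derivative \<mu>' t) (at t within ?I)" if "t \<in> ?I" for t
    unfolding \<mu>_def[abs_def] \<mu>'_def using nz(1) that
    by (auto intro!: derivative_eq_intros U' c' simp: field_simps power2_eq_square)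
  have c\<mu>': "continuous_on ?I \<mu>'"
    unfolding \<mu>'_def by (intro continuous_intros cU cc cg) (use nz in auto)
  show thesis
  proof (rule that)
    define N where "N t = 1 - ((U1 t)\<^sup>2 + (U2 t)\<^sup>2) / c t" for t
    define w where "w t = 1 / (1 - \<mu> t)\<^sup>2" for t
    show "(N has_real_derivative 2 * (\<gamma> - 1) * B\<^sub>0 * U2 t * g t / (c t)\<^sup>2) (at t within ?I)"
      if t: "t \<in> ?I" for t
    proof -
      have "(N has_real_derivative - ((2 * U1 t * U2 t + 2 * U2 t * (- U1 t - g t)) * c t
          - ((U1 t)\<^sup>2 + (U2 t)\<^sup>2) * ((\<gamma> - 1) * U2 t * g t)) / (c t * c t)) (at t within ?I)"
        unfolding N_def[abs_def] using nz(1) t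
        by (auto intro!: derivative_eq_intros U' c' simp: field_simps power2_eq_square)
      moreover have "- ((2 * U1 t * U2 t + 2 * U2 t * (- U1 t - g t)) * c t
          - ((U1 t)\<^sup>2 + (U2 t)\<^sup>2) * ((\<gamma> - 1) * U2 t * g t)) = 2 * (\<gamma> - 1) * B\<^sub>0 * U2 t * g t"
        unfolding c_def by (simp add: field_simps power2_eq_square)
      ultimately show ?thesis by (simp add: power2_eq_square)
    qed
    show "continuous_on ?I (\<lambda>t. 2 * (\<gamma> - 1) * B\<^sub>0 * U2 t * g t / (c t)\<^sup>2)"
      by (intro continuous_intros cU cc cg) (use nz in auto)
    show "0 < 2 * (\<gamma> - 1) * B\<^sub>0 * U2 t * g t / (c t)\<^sup>2" if "t \<in> ?I" for t
      using par pos[OF that] g[OF that] csq(2)[OF that] by simp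
    have "(mach \<gamma> A\<^sub>0 \<rho> U1 \<theta>so)\<^sup>2 + (mach \<gamma> A\<^sub>0 \<rho> U2 \<theta>so)\<^sup>2 = 1"
      using flow by (simp add: background_flow_def)
    then show "N \<theta>so = 0"
      using mach[of \<theta>so] par by (simp add: N_def add_divide_distrib)
    show "(w has_real_derivative 2 * (1 - \<mu> t) * \<mu>' t / ((1 - \<mu> t)\<^sup>2 * (1 - \<mu> t)\<^sup>2)) (at t within ?I)" if "t \<in> ?I" for t
      unfolding w_def[abs_def] using nz(3) that
      by (auto intro!: derivative_eq_intros \<mu>')
    show "continuous_on ?I (\<lambda>t. 2 * (1 - \<mu> t) * \<mu>' t / ((1 - \<mu> t)\<^sup>2 * (1 - \<mu> t)\<^sup>2))"
      by (intro continuous_intros c\<mu> c\<mu>') (use nz in auto)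
    show "0 < w t" if "t \<in> ?I" for t using nz(3) that by (simp add: w_def)
    show "coeff_k11 \<gamma> A\<^sub>0 \<rho> U1 U2 t = N t * w t" if "t \<in> ?I" for t
      by (simp add: coeff_k11_def mach[OF that] N_def w_def \<mu>_def add_divide_distrib diff_diff_eq)
    have cont: "continuous_on ?I (\<lambda>t. ((3 - \<gamma>) * U2 t * (U1 t + U2 t * cot t)
        + (\<gamma> + 1) * U2 t / (1 - \<mu> t) * (U1 t + U2 t * cot t)
        + (c t - 2 * (U2 t)\<^sup>2) * cot t) / (c t - (U2 t)\<^sup>2))"
      unfolding cot_def
      by (intro continuous_intros cU cc c\<mu>)
        (use nz csq(2) pos(3) in \<open>auto simp: \<mu>_def\<close>)
    have eq: "coeff_k2 \<gamma> A\<^sub>0 \<rho> U1 U2 t = ((3 - \<gamma>) * U2 t * (U1 t + U2 t * cot t)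
        + (\<gamma> + 1) * U2 t / (1 - \<mu> t) * (U1 t + U2 t * cot t)
        + (c t - 2 * (U2 t)\<^sup>2) * cot t) / (c t - (U2 t)\<^sup>2)" if "t \<in> ?I" for t
      unfolding coeff_k2_def coeff_e2_def coeff_A22_def csq(1)[OF that] mach[OF that] \<mu>_def ..
    show "continuous_on ?I (coeff_k2 \<gamma> A\<^sub>0 \<rho> U1 U2)"
      by (rule continuous_on_eq[OF cont eq[symmetric]])
  qed
qed

theorem proposition3p3:
  fixes \<gamma> A\<^sub>0 B\<^sub>0 \<theta>so U01 U02 \<theta>m \<theta>p \<theta>c r0 r1 :: real
    and \<rho> U1 U2 k11 k2 f :: "real \<Rightarrow> real"
    and D :: "(real \<times> real) set"
  assumes flow: "background_flow \<gamma> A\<^sub>0 B\<^sub>0 \<theta>so U01 U02 \<theta>m \<theta>p \<rho> U1 U2"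
    and ref: "\<theta>c \<in> {\<theta>m..\<theta>p}"
    and radii: "0 < r0" "r0 < r1"
    and k11: "k11 = coeff_k11 \<gamma> A\<^sub>0 \<rho> U1 U2"
    and k2: "k2 = coeff_k2 \<gamma> A\<^sub>0 \<rho> U1 U2"
    and f: "f = coeff_f \<gamma> A\<^sub>0 \<rho> U1 U2 \<theta>c"
    and D: "D = domain_D r0 r1 \<theta>m \<theta>p f"
  shows "\<exists>d1 d2 :: real \<Rightarrow> real.
           smooth_on {\<theta>m..\<theta>p} d1 \<and> smooth_on {\<theta>m..\<theta>p} d2 \<and>
           (\<forall>\<psi>. test_function D \<psi> \<longrightarrow>
              (LINT y:D|lborel. linear_op k11 k2 \<psi> y * multiplier d1 d2 \<psi> y)
              \<ge> 2 * (LINT y:D|lborel. (pd1 \<psi> y)\<^sup>2 + (1 / fst y * pd2 \<psi> y)\<^sup>2))"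
proof -
  have so: "\<theta>m < \<theta>p" "\<theta>so \<in> {\<theta>m..\<theta>p}" using flow by (auto simp: background_flow_def)
  obtain N N' w w' where
    N: "\<And>t. t \<in> {\<theta>m..\<theta>p} \<Longrightarrow> (N has_real_derivative N' t) (at t within {\<theta>m..\<theta>p})"
      "continuous_on {\<theta>m..\<theta>p} N'" "\<And>t. t \<in> {\<theta>m..\<theta>p} \<Longrightarrow> 0 < N' t" "N \<theta>so = 0"
    and w: "\<And>t. t \<in> {\<theta>m..\<theta>p} \<Longrightarrow> (w has_real_derivative w' t) (at t within {\<theta>m..\<theta>p})"
      "continuous_on {\<theta>m..\<theta>p} w'" "\<And>t. t \<in> {\<theta>m..\<theta>p} \<Longrightarrow> 0 < w t"
    and k11_eq: "\<And>t. t \<in> {\<theta>m..\<theta>p} \<Longrightarrow> k11 t = N t * w t"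
    and k2_cont: "continuous_on {\<theta>m..\<theta>p} k2"
    using background_flow_coefficients[OF flow] unfolding k11 k2 by metis
  define K' where "K' t = N' t * w t + N t * w' t" for t
  have K': "(k11 has_real_derivative K' t) (at t within {\<theta>m..\<theta>p})" if t: "t \<in> {\<theta>m..\<theta>p}" for t
  proof -
    have "((\<lambda>t. N t * w t) has_real_derivative K' t) (at t within {\<theta>m..\<theta>p})"
      unfolding K'_def by (auto intro!: derivative_eq_intros N w t)
    then show ?thesis
      unfolding has_field_derivative_def using t k11_eq
      by (metis (no_types, lifting) has_derivative_transform)
  qed
  have K'_cont: "continuous_on {\<theta>m..\<theta>p} K'"
    unfolding K'_def by (intro continuous_intros N(2) w(2) DERIV_continuous_on[OF N(1)]
        DERIV_continuous_on[OF w(1)])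
  obtain e1 e1' e2 e2' where
    e1: "\<And>t. t \<in> {\<theta>m..\<theta>p} \<Longrightarrow> (e1 has_real_derivative e1' t) (at t within {\<theta>m..\<theta>p})"
      "continuous_on {\<theta>m..\<theta>p} e1'"
    and e2: "\<And>t. t \<in> {\<theta>m..\<theta>p} \<Longrightarrow> (e2 has_real_derivative e2' t) (at t within {\<theta>m..\<theta>p})"
      "continuous_on {\<theta>m..\<theta>p} e2'"
    and pos: "\<And>t. t \<in> {\<theta>m..\<theta>p} \<Longrightarrow>
       0 < (N' t * w t + N t * w' t) * e2 t + N t * w t * e2' t - N t * w t * e1 t"
      "\<And>t. t \<in> {\<theta>m..\<theta>p} \<Longrightarrow> k2 t * e1 t = e1' t"
      "\<And>t. t \<in> {\<theta>m..\<theta>p} \<Longrightarrow> 0 < 2 * k2 t * e2 t - e1 t - e2' t"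
    using multiplier_coefficients_C1[OF so k2_cont N(1,3,4) w] by metis
  have pos1: "0 < K' t * e2 t + k11 t * e2' t - k11 t * e1 t" if "t \<in> {\<theta>m..\<theta>p}" for t
    using pos(1)[OF that] by (simp add: K'_def k11_eq[OF that])
  obtain d1 d1' d2 d2' where
    poly: "real_polynomial_function d1" "real_polynomial_function d2"
    and deriv: "\<And>x. (d1 has_real_derivative d1' x) (at x)" "\<And>x. (d2 has_real_derivative d2' x) (at x)"
    and form: "\<And>t X Y. t \<in> {\<theta>m..\<theta>p} \<Longrightarrow>
       2 * (X\<^sup>2 + Y\<^sup>2) \<le> (K' t * d2 t + k11 t * d2' t - k11 t * d1 t) / 2 * X\<^sup>2
         + (k2 t * d1 t - d1' t) * (X * Y) + (2 * k2 t * d2 t - d1 t - d2' t) / 2 * Y\<^sup>2"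
    using multiplier_coefficients_polynomial[OF so(1) k2_cont DERIV_continuous_on[OF K'] K'_cont
        e1(2) e2(2) e1(1) e2(1) pos1 pos(2,3)] by metis
  have cont': "continuous_on {\<theta>m<..<\<theta>p} p'"
    if p: "real_polynomial_function p" "\<And>x. (p has_real_derivative p' x) (at x)" for p p'
  proof -
    obtain q where "real_polynomial_function q" "\<And>x. (p has_real_derivative q x) (at x)"
      using has_real_derivative_polynomial_function[OF p(1)] by blast
    moreover from this have "q = p'" using p(2) DERIV_unique by blast
    ultimately show ?thesis
      by (simp add: continuous_on_polymonial_function real_polynomial_function_eq)
  qed
  have sub: "{\<theta>m<..<\<theta>p} \<subseteq> {\<theta>m..\<theta>p}" by auto
  have strip: "D \<subseteq> {0<..} \<times> {\<theta>m<..<\<theta>p}"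
  proof -
    have "0 < 1 / r1 * f t" for t using radii by (simp add: f coeff_f_def)
    then show ?thesis unfolding D domain_D_def by (auto intro: less_trans)
  qed
  have "2 * (LINT y:D|lborel. (pd1 \<psi> y)\<^sup>2 + (1 / fst y * pd2 \<psi> y)\<^sup>2)
      \<le> (LINT y:D|lborel. linear_op k11 k2 \<psi> y * multiplier d1 d2 \<psi> y)"
    if "test_function D \<psi>" for \<psi>
  proof (rule multiplier_energy_inequality[OF continuous_on_subset[OF k2_cont sub]
        continuous_on_subset[OF K'_cont sub] cont'[OF poly(1) deriv(1)] cont'[OF poly(2) deriv(2)]
        _ deriv(1) deriv(2) _ that strip])
    show "(k11 has_real_derivative K' t) (at t)" if "t \<in> {\<theta>m<..<\<theta>p}" for t
      using K'[of t] that by (simp add: at_within_Icc_at)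
  qed (use form in auto)
  then show ?thesis
    using smooth_on_real_polynomial[OF poly(1) so(1)] smooth_on_real_polynomial[OF poly(2) so(1)]
    by blast
qed

end
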